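(* Let $A=A_1+A_2$ be the core-EP decomposition of $A\in\mathbb{C}_{n,n}$, where $A_1$ is the core-invertible part and $A_2$ is the nilpotent part. Then the core-EP inverse of $A$ equals the core inverse of $A_1$: $$A^{(\dag)}=A_1^{(\#)}.$$
   Context: $\mathbb{C}_{n,n}$ is the set of $n\times n$ complex matrices, $A^\ast$ is the conjugate transpose, $\mathrm{rk}$ the rank, $\mathcal{R}(A)$ the column space, $A^\dag$ the Moore-Penrose inverse. The index $\mathrm{Ind}(A)$ is $0$ if $A$ is non-singular, and otherwise is the smallest positive integer $k$ with $\mathrm{rk}(A^{k+1})=\mathrm{rk}(A^k)$. $\mathbb{C}_n^{\mathtt{CM}}=\{A\in\mathbb{C}_{n,n} : \mathrm{rk}(A^2)=\mathrm{rk}(A)\}$ (core-invertible matrices). Core-EP decomposition: for $A\in\mathbb{C}_{n,n}$ with $\mathrm{Ind}(A)=k$, it is the (existing and unique) decomposition $A=A_1+A_2$ with (i) $A_1\in\mathbb{C}_n^{\mathtt{CM}}$; (ii) $A_2^k=0$ (read as $A_2=0$ when $k=0$); (iii) $A_1^\ast A_2=A_2A_1=0$. Core inverse: for $A\in\mathbb{C}_n^{\mathtt{CM}}$, $A^{(\#)}$ is the unique $X\in\mathbb{C}_{n,n}$ with $AX=AA^\dag$ and $\mathcal{R}(X)\subseteq\mathcal{R}(A)$. Core-EP inverse: for $A\in\mathbb{C}_{n,n}$ with $\mathrm{Ind}(A)=k$, $A^{(\dag)}$ is the unique $X\in\mathbb{C}_{n,n}$ satisfying $XA^{k+1}=A^k$,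 $XAX=X$, $(AX)^\ast=AX$ and $\mathcal{R}(X)\subseteq\mathcal{R}(A^k)$. *)

theory Defs
  imports "HOL-Analysis.Analysis"
begin

text \<open>
  A complex $n \times n$ matrix is an element of \<^typ>\<open>complex^'n^'n\<close>. The library's \<^const>\<open>rank\<close> is the
  rank over the field of the entries (the dimension of the row space), and the column space
  is the span over that same field, hence \<^const>\<open>vec.span\<close> and not the real \<^const>\<open>span\<close>.
\<close>

definition conj_transpose :: "complex^'n^'m \<Rightarrow> complex^'m^'n" where
  "conj_transpose A = (\<chi> i j. cnj (A $ j $ i))"

text \<open>Powers with respect to the matrix product; on vectors the class operation \<open>*\<close> is componentwise.\<close>

primrec mat_pow :: "complex^'n^'n \<Rightarrow> nat \<Rightarrow> complex^'n^'n" where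
  "mat_pow A 0 = mat 1"
| "mat_pow A (Suc k) = A ** mat_pow A k"

definition column_space :: "complex^'n^'m \<Rightarrow> (complex^'m) set" where
  "column_space A = vec.span (columns A)"

definition mat_index :: "complex^'n^'n \<Rightarrow> nat" where
  "mat_index A =
    (if invertible A then 0
     else (LEAST k. 0 < k \<and> rank (mat_pow A (k + 1)) = rank (mat_pow A k)))"

definition core_invertible :: "complex^'n^'n \<Rightarrow> bool" where
  "core_invertible A \<longleftrightarrow> rank (mat_pow A 2) = rank A"

text \<open>The Moore--Penrose inverse, given by the four Penrose equations.\<close>

definition moore_penrose :: "complex^'n^'m \<Rightarrow> complex^'m^'n" where
  "moore_penrose A =
    (THE X. A ** X ** A = A \<and> X ** A ** X = X
          \<and> conj_transpose (A ** X) = A ** X \<and> conj_transpose (X ** A) = X ** A)"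

text \<open>Only meaningful for core-invertible arguments.\<close>

definition core_inverse :: "complex^'n^'n \<Rightarrow> complex^'n^'n" where
  "core_inverse A =
    (THE X. A ** X = A ** moore_penrose A \<and> column_space X \<subseteq> column_space A)"

definition core_EP_inverse :: "complex^'n^'n \<Rightarrow> complex^'n^'n" where
  "core_EP_inverse A =
    (THE X. X ** mat_pow A (mat_index A + 1) = mat_pow A (mat_index A)
          \<and> X ** A ** X = X
          \<and> conj_transpose (A ** X) = A ** X
          \<and> column_space X \<subseteq> column_space (mat_pow A (mat_index A)))"

text \<open>
  For index $0$ the nilpotency condition is read as $A_2 = 0$: taken literally, the zeroth power
  would be the identity matrix and the condition could not hold.
\<close>

definition core_EP_decomposition ::
    "complex^'n^'n \<Rightarrow> complex^'n^'n \<Rightarrow> complex^'n^'n \<Rightarrow> bool" where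
  "core_EP_decomposition A A1 A2 \<longleftrightarrow>
     A = A1 + A2
     \<and> core_invertible A1
     \<and> (if mat_index A = 0 then A2 = 0 else mat_pow A2 (mat_index A) = 0)
     \<and> conj_transpose A1 ** A2 = 0 \<and> A2 ** A1 = 0"

end

theory Submission
  imports Defs
begin

text \<open>
  Write \<open>B = A1\<close> and let \<open>k\<close> be the index of \<open>A\<close>. Since \<open>A2 B = 0\<close>, we have \<open>A B = B\<^sup>2\<close>, and since
  \<open>A2\<close> is nilpotent, \<open>A\<^sup>k\<close> and \<open>B\<close> have the same column space. As \<open>B\<close> is injective on its column
  space, the core inverse \<open>X\<close> of \<open>B\<close> satisfies \<open>X B\<^sup>2 = B\<close> and \<open>X B X = X\<close>, and because the columns
  of \<open>X\<close> and \<open>A\<^sup>k\<close> lie in the column space of \<open>B\<close>, \<open>A\<close> may replace \<open>B\<close> throughout.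
\<close>

section \<open>Column spaces and rank over a field\<close>

lemma span_columns_eq_range:
  fixes A :: "'a::field^'n^'m"
  shows "vec.span (columns A) = range ((*v) A)"
proof
  have "vec.subspace (range ((*v) A))"
    by (rule vec.linear_subspace_image[OF matrix_vector_mul_linear_gen vec.subspace_UNIV])
  moreover have "column i A = A *v axis i 1" for i
    by (simp add: vec_eq_iff column_def matrix_vector_mult_def axis_def if_distrib cong: if_cong)
  then have "columns A \<subseteq> range ((*v) A)"
    by (auto simp: columns_def)
  ultimately show "vec.span (columns A) \<subseteq> range ((*v) A)"
    by (simp add: vec.span_minimal)
qed (auto intro: matrix_vector_mult_in_columnspace_gen)

text \<open>The map \<open>A *v x\<close> has a linear right inverse on its range; \<open>G\<close>
  is its matrix.\<close>

lemma exists_generalized_inverse: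
  fixes A :: "'a::field^'n^'m"
  shows "\<exists>G. A ** G ** A = A"
proof -
  obtain g where "Vector_Spaces.linear (*s) (*s) g"
    and g: "\<forall>v\<in>range ((*v) A). A *v g v = v"
    using vec.linear_exists_right_inverse_on[OF matrix_vector_mul_linear_gen[of A] vec.subspace_UNIV]
    by auto
  then have "A *v (matrix g *v (A *v x)) = A *v x" for x
    by (simp add: matrix_works)
  then have "A ** matrix g ** A = A"
    by (simp add: matrix_eq flip: matrix_vector_mul_assoc)
  then show ?thesis ..
qed

text \<open>Turns inclusions of column spaces into matrix equations. Since \<open>A ** G\<close>
  fixes the column space of \<open>A\<close>, the factor can be taken as
  \<open>G ** B\<close>.\<close>

lemma span_columns_subset_iff:
  fixes A :: "'a::field^'n^'m" and B :: "'a^'p^'m"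
  shows "vec.span (columns B) \<subseteq> vec.span (columns A) \<longleftrightarrow> (\<exists>V. B = A ** V)"
proof
  assume sub: "vec.span (columns B) \<subseteq> vec.span (columns A)"
  obtain G where G: "A ** G ** A = A"
    using exists_generalized_inverse by blast
  have "A *v (G *v (B *v x)) = B *v x" for x
  proof -
    obtain y where "B *v x = A *v y"
      using sub by (force simp: span_columns_eq_range)
    then show ?thesis
      by (metis G matrix_vector_mul_assoc)
  qed
  then have "B = A ** (G ** B)"
    by (metis matrix_eq matrix_vector_mul_assoc)
  then show "\<exists>V. B = A ** V" ..
qed (auto simp: span_columns_eq_range simp flip: matrix_vector_mul_assoc)

text \<open>For a generalized inverse \<open>G\<close> of \<open>B\<close>, each
  \<open>x - G *v (B *v x)\<close> lies in the kernel of \<open>B\<close>, hence in that of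
  \<open>C\<close>, so \<open>C = C ** G ** B\<close>.\<close>

lemma factor_through_left:
  fixes B :: "'a::field^'n^'m" and C :: "'a^'n^'p"
  assumes "\<And>x. B *v x = 0 \<Longrightarrow> C *v x = 0"
  shows "\<exists>Y. C = Y ** B"
proof -
  obtain G where G: "B ** G ** B = B"
    using exists_generalized_inverse by blast
  have "C *v (x - G *v (B *v x)) = 0" for x
    by (rule assms) (simp add: matrix_vector_mult_diff_distrib matrix_vector_mul_assoc matrix_mul_assoc G)
  then have "C = (C ** G) ** B"
    by (simp add: matrix_eq matrix_vector_mult_diff_distrib flip: matrix_vector_mul_assoc)
  then show ?thesis ..
qed

lemma matrix_add_rdistrib: "(A + B) ** C = A ** C + B ** C"
  by (vector matrix_matrix_mult_def sum.distrib[symmetric] field_simps)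

lemma rank_mult_le_right:
  fixes A :: "'a::field^'n^'m" and B :: "'a^'p^'n"
  shows "rank (A ** B) \<le> rank B"
proof -
  have "vec.span (columns (transpose (A ** B))) \<subseteq> vec.span (columns (transpose B))"
    unfolding span_columns_subset_iff by (auto simp: matrix_transpose_mul)
  from vec.dim_subset[OF this] show ?thesis
    by (simp add: row_rank_def_gen)
qed

text \<open>\<^const>\<open>rank\<close> is defined through rows, so the first factorization is read off directly, whereas
  the second one needs a dimension count.\<close>

lemma rank_square_eq_factors:
  fixes A :: "'a::field^'n^'n"
  assumes "rank (A ** A) = rank A"
  shows "\<exists>Y. A = Y ** (A ** A)" and "\<exists>Z. A = A ** A ** Z"
proof -
  let ?r = "\<lambda>M::'a^'n^'n. vec.span (columns (transpose M))"
  have "?r (A ** A) \<subseteq> ?r A"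
    unfolding span_columns_subset_iff by (auto simp: matrix_transpose_mul)
  moreover have "vec.dim (?r A) \<le> vec.dim (?r (A ** A))"
    using assms by (simp add: row_rank_def_gen)
  ultimately have "?r (A ** A) = ?r A"
    by (intro vec.subspace_dim_equal) (auto intro: vec.subspace_span)
  then obtain V where "transpose A = transpose (A ** A) ** V"
    using span_columns_subset_iff by blast
  then have Y: "A = transpose V ** (A ** A)"
    by (metis matrix_transpose_mul transpose_transpose)
  then show "\<exists>Y. A = Y ** (A ** A)" ..
  \<comment> \<open>\<open>transpose V\<close> maps the range of \<open>A ** A\<close> onto that of
    \<open>A\<close>, so the included range has at least the dimension of the larger one.\<close>
  have "(*v) (transpose V) ` range ((*v) (A ** A)) = range ((*v) A)"
    using Y by (metis (no_types, lifting) image_cong image_image matrix_vector_mul_assoc)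
  then have "vec.dim (range ((*v) A)) \<le> vec.dim (range ((*v) (A ** A)))"
    by (metis vec.dim_image_le matrix_vector_mul_linear_gen)
  moreover have "range ((*v) (A ** A)) \<subseteq> range ((*v) A)"
    by (auto simp flip: matrix_vector_mul_assoc)
  ultimately have "range ((*v) (A ** A)) = range ((*v) A)"
    by (intro vec.subspace_dim_equal) (auto simp flip: span_columns_eq_range)
  then show "\<exists>Z. A = A ** A ** Z"
    by (metis span_columns_eq_range span_columns_subset_iff order_refl)
qed

section \<open>The Moore--Penrose inverse\<close>

lemma conj_transpose_mult: "conj_transpose (A ** B) = conj_transpose B ** conj_transpose A"
  by (simp add: conj_transpose_def matrix_matrix_mult_def vec_eq_iff mult.commute)

lemma conj_transpose_conj_transpose [simp]: "conj_transpose (conj_transpose A) = A"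
  by (simp add: conj_transpose_def vec_eq_iff)

text \<open>For \<open>y = A *v x\<close>, the squared norm of \<open>y\<close> is the inner product
  of \<open>x\<close> with \<open>conj_transpose A *v y\<close>, which vanishes.\<close>

lemma gram_matrix_kernel:
  fixes A :: "complex^'n^'m"
  assumes "(conj_transpose A ** A) *v x = 0"
  shows "A *v x = 0"
proof -
  let ?y = "A *v x"
  have "complex_of_real (\<Sum>i\<in>UNIV. (cmod (?y $ i))\<^sup>2)
      = (\<Sum>i\<in>UNIV. cnj (?y $ i) * ?y $ i)"
    by (simp only: of_real_sum complex_norm_square mult.commute)
  also have "\<dots> = (\<Sum>i\<in>UNIV. \<Sum>j\<in>UNIV. cnj (A $ i $ j) * cnj (x $ j) * ?y $ i)"
    by (simp add: matrix_vector_mult_def sum_distrib_right)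
  also have "\<dots> = (\<Sum>j\<in>UNIV. \<Sum>i\<in>UNIV. cnj (A $ i $ j) * cnj (x $ j) * ?y $ i)"
    by (rule sum.swap)
  also have "\<dots> = (\<Sum>j\<in>UNIV. cnj (x $ j) * (conj_transpose A *v ?y) $ j)"
    by (subst (2) matrix_vector_mult_def) (simp add: conj_transpose_def sum_distrib_left mult_ac)
  also have "\<dots> = 0"
    using assms by (simp add: matrix_vector_mul_assoc)
  finally have "(\<Sum>i\<in>UNIV. (cmod (?y $ i))\<^sup>2) = 0"
    using of_real_eq_0_iff by blast
  then show ?thesis
    by (simp add: sum_nonneg_eq_0_iff vec_eq_iff)
qed

text \<open>By the kernel lemma \<open>A\<close> is some \<open>Y\<close> times its Gram matrix.
  With \<open>G = conj_transpose Y\<close>, the product \<open>A ** G\<close> is the Gram matrix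
  between \<open>Y\<close> and its adjoint, hence Hermitian.\<close>

lemma exists_13_inverse:
  fixes A :: "complex^'n^'m"
  shows "\<exists>G. A ** G ** A = A \<and> conj_transpose (A ** G) = A ** G"
proof -
  obtain Y where Y: "A = Y ** (conj_transpose A ** A)"
    using factor_through_left gram_matrix_kernel by blast
  have "A ** conj_transpose Y = Y ** conj_transpose A ** A ** conj_transpose Y"
    using Y by (simp add: matrix_mul_assoc)
  then have herm: "conj_transpose (A ** conj_transpose Y) = A ** conj_transpose Y"
    by (metis conj_transpose_conj_transpose conj_transpose_mult matrix_mul_assoc)
  then have "A ** conj_transpose Y ** A = A"
    by (metis Y conj_transpose_conj_transpose conj_transpose_mult matrix_mul_assoc)
  with herm show ?thesis by blast
qed

definition penrose :: "complex^'n^'m \<Rightarrow> complex^'m^'n \<Rightarrow> bool" where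
  "penrose A X \<longleftrightarrow> A ** X ** A = A \<and> X ** A ** X = X
     \<and> conj_transpose (A ** X) = A ** X \<and> conj_transpose (X ** A) = X ** A"

text \<open>One inverse \<open>G\<close> makes \<open>A ** G\<close> Hermitian; the adjoint
  \<open>H\<close> of such an inverse of \<open>conj_transpose A\<close> makes \<open>H ** A\<close>
  Hermitian. The product \<open>H ** A ** G\<close> inherits both properties.\<close>

lemma penrose_exists: "\<exists>X. penrose A X"
proof -
  obtain G where G: "A ** G ** A = A" "conj_transpose (A ** G) = A ** G"
    using exists_13_inverse by blast
  obtain K where K: "conj_transpose A ** K ** conj_transpose A = conj_transpose A"
      "conj_transpose (conj_transpose A ** K) = conj_transpose A ** K"
    using exists_13_inverse by blast
  define H where "H = conj_transpose K"
  have H: "A ** H ** A = A" "conj_transpose (H ** A) = H ** A"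
    using arg_cong[OF K(1), of conj_transpose] K(2)
    by (simp_all add: H_def conj_transpose_mult matrix_mul_assoc)
  have "A ** (H ** A ** G) = A ** G" "H ** A ** G ** A = H ** A"
    using G(1) H(1) by (metis matrix_mul_assoc)+
  moreover have "H ** A ** (H ** A ** G) = H ** A ** G"
    using H(1) by (metis matrix_mul_assoc)
  ultimately have "penrose A (H ** A ** G)"
    using G H by (simp add: penrose_def)
  then show ?thesis ..
qed

text \<open>Taking adjoints in \<open>A ** X = (A ** Y) ** (A ** X)\<close> swaps the Hermitian
  factors and gives \<open>A ** X = A ** Y\<close>; likewise on the other side.\<close>

lemma penrose_unique:
  assumes X: "penrose A X" and Y: "penrose A Y"
  shows "X = Y"
proof -
  have "A ** X = (A ** Y) ** (A ** X)" "A ** Y = (A ** X) ** (A ** Y)"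
    using X Y by (simp_all add: penrose_def matrix_mul_assoc)
  then have AX: "A ** X = A ** Y"
    using X Y by (metis conj_transpose_mult penrose_def)
  have "X ** A = (X ** A) ** (Y ** A)" "Y ** A = (Y ** A) ** (X ** A)"
    using X Y by (metis matrix_mul_assoc penrose_def)+
  then have XA: "X ** A = Y ** A"
    using X Y by (metis conj_transpose_mult penrose_def)
  have "X = X ** (A ** X)"
    using X by (simp add: penrose_def matrix_mul_assoc)
  also have "\<dots> = (X ** A) ** Y"
    by (simp add: AX matrix_mul_assoc)
  also have "\<dots> = Y"
    using Y by (simp add: XA penrose_def)
  finally show ?thesis .
qed

lemma penrose_moore_penrose: "penrose A (moore_penrose A)"
  unfolding moore_penrose_def penrose_def[symmetric]
  by (rule theI') (use penrose_exists penrose_unique in blast)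

section \<open>The core inverse and the core-EP inverse\<close>

lemma column_space_subset_iff:
  fixes A :: "complex^'n^'m" and B :: "complex^'p^'m"
  shows "column_space B \<subseteq> column_space A \<longleftrightarrow> (\<exists>V. B = A ** V)"
  by (simp add: column_space_def span_columns_subset_iff)

lemma core_invertible_alt: "core_invertible A \<longleftrightarrow> rank (A ** A) = rank A"
  by (simp add: core_invertible_def numeral_2_eq_2)

text \<open>Injectivity of \<open>A\<close> on its column space: some \<open>Y\<close> recovers
  \<open>A\<close> from \<open>A ** A\<close>.\<close>

lemma core_invertible_cancel:
  assumes "core_invertible A" and "A ** A ** U = A ** A ** V"
  shows "A ** U = A ** V"
proof -
  obtain Y where "A = Y ** (A ** A)"
    using assms(1) rank_square_eq_factors(1) by (auto simp: core_invertible_alt)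
  then show ?thesis
    using assms(2) by (metis matrix_mul_assoc)
qed

text \<open>The \<open>THE\<close> can be used only after existence, from a factorization of
  \<open>A\<close> through \<open>A ** A\<close>, and uniqueness, from cancelling
  \<open>A\<close>.\<close>

lemma core_inverse_props:
  assumes A: "core_invertible A"
  shows "A ** core_inverse A = A ** moore_penrose A"
    and "column_space (core_inverse A) \<subseteq> column_space A"
proof -
  let ?P = "\<lambda>X. A ** X = A ** moore_penrose A \<and> column_space X \<subseteq> column_space A"
  obtain Z where Z: "A = A ** A ** Z"
    using A rank_square_eq_factors(2) by (auto simp: core_invertible_alt)
  have "A ** (A ** Z ** moore_penrose A) = A ** moore_penrose A"
    by (metis Z matrix_mul_assoc)
  moreover have "column_space (A ** Z ** moore_penrose A) \<subseteq> column_space A"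
    by (auto simp: column_space_subset_iff simp flip: matrix_mul_assoc)
  ultimately have "?P (A ** Z ** moore_penrose A)" ..
  moreover have "X = Y" if XY: "?P X" "?P Y" for X Y
  proof -
    obtain U V where "X = A ** U" "Y = A ** V"
      using XY by (metis column_space_subset_iff)
    then show ?thesis
      using core_invertible_cancel[OF A, of U V] XY by (simp add: matrix_mul_assoc)
  qed
  ultimately have "\<exists>!X. ?P X"
    by metis
  then have "?P (core_inverse A)"
    unfolding core_inverse_def by (rule theI')
  then show "A ** core_inverse A = A ** moore_penrose A"
    "column_space (core_inverse A) \<subseteq> column_space A" by auto
qed

text \<open>Writing \<open>X = A ** V\<close> makes both sides of the two product identities
  multiples of \<open>A\<close> from the left. After multiplying by \<open>A\<close> they follow
  from \<open>A ** X ** A = A\<close>, and \<open>A\<close> cancels.\<close>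

lemma core_inverse_equations:
  assumes A: "core_invertible A" and X: "X = core_inverse A"
  shows "X ** A ** A = A" and "X ** A ** X = X" and "conj_transpose (A ** X) = A ** X"
proof -
  have AX: "A ** X = A ** moore_penrose A"
    using core_inverse_props(1)[OF A] X by simp
  obtain V where V: "X = A ** V"
    using core_inverse_props(2)[OF A] X by (auto simp: column_space_subset_iff)
  have AXA: "A ** X ** A = A" and "conj_transpose (A ** X) = A ** X"
    using penrose_moore_penrose[of A] by (simp_all add: AX penrose_def)
  then show "conj_transpose (A ** X) = A ** X" by simp
  have "A ** (V ** A ** A) = A ** mat 1"
    by (rule core_invertible_cancel[OF A]) (use AXA in \<open>simp add: V matrix_mul_assoc\<close>)
  then show "X ** A ** A = A"
    by (simp add: V matrix_mul_assoc)
  have "A ** (V ** A ** X) = A ** V"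
    by (rule core_invertible_cancel[OF A]) (use AXA in \<open>simp add: V matrix_mul_assoc\<close>)
  then show "X ** A ** X = X"
    by (simp add: V matrix_mul_assoc)
qed

text \<open>\<open>Y ** A\<close> fixes the columns of \<open>mat_pow A k\<close>, hence those of
  \<open>X\<close>, and symmetrically. So \<open>A ** X\<close> and \<open>A ** Y\<close> absorb
  each other, and being Hermitian they agree.\<close>

lemma core_EP_inverse_unique:
  fixes A X Y :: "complex^'n^'n"
  assumes X: "X ** mat_pow A (k + 1) = mat_pow A k" "X ** A ** X = X"
      "conj_transpose (A ** X) = A ** X" "column_space X \<subseteq> column_space (mat_pow A k)"
    and Y: "Y ** mat_pow A (k + 1) = mat_pow A k" "Y ** A ** Y = Y"
      "conj_transpose (A ** Y) = A ** Y" "column_space Y \<subseteq> column_space (mat_pow A k)"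
  shows "X = Y"
proof -
  obtain U V where UV: "X = mat_pow A k ** U" "Y = mat_pow A k ** V"
    using X Y by (auto simp: column_space_subset_iff)
  have YAX: "Y ** A ** X = X"
    using Y(1) by (simp add: UV(1) matrix_mul_assoc)
  have XAY: "X ** A ** Y = Y"
    using X(1) by (simp add: UV(2) matrix_mul_assoc)
  have "A ** X = (A ** Y) ** (A ** X)" "A ** Y = (A ** X) ** (A ** Y)"
    using YAX XAY by (metis matrix_mul_assoc)+
  then have "A ** X = A ** Y"
    using X(3) Y(3) by (metis conj_transpose_mult)
  then show ?thesis
    using YAX Y(2) by (metis matrix_mul_assoc)
qed

section \<open>Powers of the sum, and the index\<close>

lemma mat_pow_mult_left:
  assumes "A ** B = B ** B"
  shows "mat_pow A j ** B = mat_pow B (Suc j)"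
proof (induction j)
  case (Suc j)
  have "mat_pow A (Suc j) ** B = A ** mat_pow B (Suc j)"
    using Suc by (simp flip: matrix_mul_assoc)
  then show ?case
    using assms by (simp add: matrix_mul_assoc)
qed simp

text \<open>Replacing the second \<open>B\<close> in \<open>B ** B ** Z\<close> by its factorization
  raises the power by one.\<close>

lemma core_invertible_factor_pow:
  assumes "core_invertible B"
  shows "\<exists>W. B = mat_pow B (Suc j) ** W"
proof (induction j)
  case 0
  show ?case by (auto intro: exI[of _ "mat 1"])
next
  case (Suc j)
  then obtain W where W: "B = mat_pow B (Suc j) ** W" ..
  obtain Z where Z: "B = B ** B ** Z"
    using assms rank_square_eq_factors(2) by (auto simp: core_invertible_alt)
  have "B = B ** (mat_pow B (Suc j) ** W) ** Z"
    using Z W by simp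
  then have "B = mat_pow B (Suc (Suc j)) ** (W ** Z)"
    by (simp add: matrix_mul_assoc)
  then show ?case ..
qed

text \<open>In the expanded power every word with \<open>C\<close> directly before \<open>B\<close>
  vanishes, so each surviving word except the pure power of \<open>C\<close> starts with
  \<open>B\<close>.\<close>

lemma mat_pow_sum_factor:
  assumes "C ** B = 0"
  shows "\<exists>Z. mat_pow (B + C) (Suc j) = B ** Z + mat_pow C (Suc j)"
proof (induction j)
  case 0
  show ?case by (auto intro: exI[of _ "mat 1"])
next
  case (Suc j)
  then obtain Z where Z: "mat_pow (B + C) (Suc j) = B ** Z + mat_pow C (Suc j)" ..
  have "C ** (B ** Z) = 0"
    using assms by (simp add: matrix_mul_assoc)
  then have "(B + C) ** (B ** Z + mat_pow C (Suc j))
      = B ** (B ** Z + mat_pow C (Suc j)) + mat_pow C (Suc (Suc j))"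
    by (simp add: matrix_add_ldistrib matrix_add_rdistrib)
  then show ?case
    using Z by (metis mat_pow.simps(2))
qed

text \<open>The \<open>LEAST\<close> of an unsatisfiable predicate could be \<open>0\<close>, so the ranks of the powers have to be
shown to stabilise.\<close>

lemma mat_index_eq_0_iff: "mat_index A = 0 \<longleftrightarrow> invertible A"
proof
  define r where "r k = rank (mat_pow A k)" for k
  have le: "r (Suc k) \<le> r k" for k
    by (simp add: r_def rank_mult_le_right)
  have "\<exists>k>0. r (k + 1) = r k"
  proof (rule ccontr)
    assume "\<not> ?thesis"
    then have less: "r (Suc k) < r k" if "k > 0" for k
      using le[of k] that by (metis Suc_eq_plus1 le_neq_implies_less)
    \<comment> \<open>Strictly falling ranks lose at least one per step and would exhaust
      \<open>r 1\<close>.\<close>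
    have "r (Suc k) + k \<le> r 1" for k
    proof (induction k)
      case (Suc k)
      then show ?case using less[of "Suc k"] by simp
    qed simp
    from this[of "Suc (r 1)"] show False by simp
  qed
  then have "0 < (LEAST k. 0 < k \<and> r (k + 1) = r k)"
    by (metis (mono_tags, lifting) LeastI_ex)
  then show "mat_index A = 0 \<Longrightarrow> invertible A"
    by (auto simp: mat_index_def r_def split: if_splits)
qed (simp add: mat_index_def)

theorem theorem3p2:
  fixes A A1 A2 :: "complex^'n^'n"
  assumes "core_EP_decomposition A A1 A2"
  shows "core_EP_inverse A = core_inverse A1"
proof -
  define k where "k = mat_index A"
  define X where "X = core_inverse A1"
  have A: "A = A1 + A2" and core: "core_invertible A1" and A21: "A2 ** A1 = 0"
    and nil: "if k = 0 then A2 = 0 else mat_pow A2 k = 0"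
    using assms by (auto simp: core_EP_decomposition_def k_def split: if_splits)
  note X = core_inverse_equations[OF core X_def]
  have AA1: "A ** A1 = A1 ** A1"
    by (simp add: A A21 matrix_add_rdistrib)
  \<comment> \<open>\<open>A\<close> acts as \<open>A1\<close> on the column space of
    \<open>A1\<close>, so \<open>mat_pow A1 (Suc k)\<close> is
    \<open>mat_pow A k ** A1\<close>.\<close>
  obtain W where W: "A1 = mat_pow A k ** (A1 ** W)"
    using core_invertible_factor_pow[OF core, of k] mat_pow_mult_left[OF AA1, of k]
    by (auto simp: matrix_mul_assoc)
  \<comment> \<open>For positive \<open>k\<close> the nilpotent summand drops out. For
    \<open>k = 0\<close>, \<open>A = A1\<close> is invertible and its inverse is the factor.\<close>
  obtain Z where Z: "mat_pow A k = A1 ** Z"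
  proof (cases k)
    case 0
    then have "invertible A"
      using mat_index_eq_0_iff k_def by metis
    then obtain B where "A ** B = mat 1"
      by (auto simp: invertible_def)
    with 0 nil A that[of B] show ?thesis
      by simp
  next
    case (Suc j)
    then show ?thesis
      using mat_pow_sum_factor[OF A21, of j] nil A that by auto
  qed
  obtain V where V: "X = A1 ** V"
    using core_inverse_props(2)[OF core] by (auto simp: X_def column_space_subset_iff)
  \<comment> \<open>The columns of \<open>X\<close> lie in the column space of \<open>A1\<close>,
    which \<open>A2\<close> annihilates.\<close>
  have AX: "A ** X = A1 ** X"
    by (simp add: V AA1 matrix_mul_assoc)
  \<comment> \<open>The extra factor \<open>A\<close> is split off on the left, where it meets
    \<open>A1\<close> and acts as \<open>A1\<close>; then \<open>X ** A1 ** A1 = A1\<close>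
    applies.\<close>
  have "X ** mat_pow A (k + 1) = X ** (A ** A1) ** Z"
    by (simp add: Z matrix_mul_assoc)
  then have "X ** mat_pow A (k + 1) = mat_pow A k"
    using X(1) by (simp add: AA1 Z matrix_mul_assoc)
  moreover have "X ** A ** X = X"
    using X(2) AX by (metis matrix_mul_assoc)
  moreover have "conj_transpose (A ** X) = A ** X"
    using X(3) AX by simp
  moreover have "column_space X \<subseteq> column_space (mat_pow A k)"
    unfolding column_space_subset_iff using V W by (metis matrix_mul_assoc)
  ultimately have "core_EP_inverse A = X"
    unfolding core_EP_inverse_def k_def
    by (intro the_equality) (auto intro: core_EP_inverse_unique)
  then show ?thesis
    by (simp add: X_def)
qed

end
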